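(* Let $(J,R,Q,B)\in\Sigma_{n,m}$ be such that the pencil $s\mathcal{E}-\mathcal{A}_S$ is singular for $S=0$. Let $\omega\in\mathbb{R}$ with $i\omega\notin\sigma(JQ)$ and consider the subspace $$V:=B^{-1}(JQ-i\omega I)\ker RQ.$$ Let $S\in\mathbb{K}^{m\times m}$ with $S=S^H\ge0$ and $\ker S=V^\bot$ (e.g. the orthogonal projection onto $V$). Then $s\mathcal{E}-\mathcal{A}_S$ is a regular pencil. Moreover, if $\omega$ is chosen such that $$\dim B^{-1}(JQ-i\omega I)\ker RQ=\min\{\dim B^{-1}(JQ-zI)\ker RQ\,:\,z\in\mathbb{C}\},$$ which holds for all but finitely many $\omega\in\mathbb{R}$ with $i\omega\notin\sigma(JQ)$, then $$\operatorname{rk}S=\min\big\{\operatorname{rk}\widehat S\,:\,\widehat S\in\mathbb{K}^{m\times m},\ \widehat S=\widehat S^H\ge0,\ s\mathcal{E}-\mathcal{A}_{\widehat S}\text{ is regular}\big\}.$$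
   Context: $\mathbb{K}\in\{\mathbb{R},\mathbb{C}\}$, $n,m$ are positive integers with $m\le n$, $A^H$ is the conjugate transpose, $\sigma(A)$ is the set of (complex) eigenvalues of a square matrix $A$, $\operatorname{rk}$ is the rank, and $A\ge0$ means $x^HAx\ge0$ for all $x$. $\Sigma_{n,m}$ is the set of all $(J,R,Q,B)\in(\mathbb{K}^{n\times n})^3\times\mathbb{K}^{n\times m}$ with $J=-J^H$, $R=R^H\ge0$, $Q=Q^H\ge0$. For $S\in\mathbb{K}^{m\times m}$, the optimality pencil $s\mathcal{E}-\mathcal{A}_S$ has coefficients $$\mathcal{E}=\begin{bmatrix}0_{n\times n}&I_n&0_{n\times m}\\-I_n&0_{n\times n}&0_{n\times m}\\0_{m\times n}&0_{m\times n}&0_{m\times m}\end{bmatrix},\qquad \mathcal{A}_S=\begin{bmatrix}0_{n\times n}&(J-R)Q&B\\((J-R)Q)^H&QRQ&0_{n\times m}\\ B^H&0_{m\times n}&S\end{bmatrix}.$$ It is called regular if $\det(s\mathcal{E}-\mathcal{A}_S)$ is not the zero polynomial in $s$, and singular otherwise. $B^{-1}W$ denotes the preimage $\{u:Bu\in W\}$ of a subspace $W$, $(JQ-zI)\ker RQ$ is the image of $\ker RQ$ under $JQ-zI$, and $V^\bot$ is the orthogonal complement with respect to the standard inner product. If $\mathbb{K}=\mathbb{R}$, all kernels, images, preimages, dimensions and orthogonal complements here are taken over $\mathbb{C}$.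
   Formalization: "All but finitely many ω" is stated with the minimum over z not in σ(JQ), since over all z in ℂ it fails (n=m=1, J=R=0, Q=B=1); the rank formula is given for both minima. For K=ℝ the orthogonal projection onto V is not claimed to be real, as it can be non-real. *)

theory Defs
  imports "HOL-Analysis.Analysis" "HOL-Computational_Algebra.Polynomial"
begin

text \<open>
  Both base fields are treated inside the complex matrices: the field is a set \<open>K\<close> of complex
  numbers, either \<open>\<real>\<close> or \<open>UNIV\<close>, and a matrix over it is a complex matrix with entries in \<open>K\<close>.
  Kernels, images, preimages, orthogonal complements, \<open>vec.dim\<close> and \<open>rank\<close> are thus over the
  complex numbers in both cases.
\<close>

definition entries_in :: "complex set \<Rightarrow> complex^'c^'r \<Rightarrow> bool"
  where "entries_in K A \<longleftrightarrow> (\<forall>i j. A $ i $ j \<in> K)"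

definition conj_transpose :: "complex^'c^'r \<Rightarrow> complex^'r^'c"
  where "conj_transpose A = map_matrix cnj (transpose A)"

definition hinner :: "complex^'k \<Rightarrow> complex^'k \<Rightarrow> complex"
  where "hinner x y = (\<Sum>i\<in>UNIV. cnj (x $ i) * y $ i)"

definition hermitian :: "complex^'k^'k \<Rightarrow> bool"
  where "hermitian A \<longleftrightarrow> A = conj_transpose A"

text \<open>The vectors \<open>x\<close> range over \<open>K\<^sup>k\<close>; the form is required to be real and nonnegative.\<close>

definition psd_over :: "complex set \<Rightarrow> complex^'k^'k \<Rightarrow> bool"
  where "psd_over K A \<longleftrightarrow>
    (\<forall>x. (\<forall>i. x $ i \<in> K) \<longrightarrow> hinner x (A *v x) \<in> \<real>\<^sub>\<ge>\<^sub>0)"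

definition mat_ker :: "complex^'c^'r \<Rightarrow> (complex^'c) set"
  where "mat_ker A = {x. A *v x = 0}"

definition eigenvalues :: "complex^'k^'k \<Rightarrow> complex set"
  where "eigenvalues A = {z. \<exists>x. x \<noteq> 0 \<and> A *v x = z *s x}"

text \<open>Hermitian, not real, orthogonality (in contrast to \<open>orthogonal_comp\<close>).\<close>

definition horth_comp :: "(complex^'k) set \<Rightarrow> (complex^'k) set"
  where "horth_comp V = {y. \<forall>x\<in>V. hinner x y = 0}"

definition is_orth_projection :: "complex^'k^'k \<Rightarrow> (complex^'k) set \<Rightarrow> bool"
  where "is_orth_projection P V \<longleftrightarrow> (\<forall>x. P *v x \<in> V \<and> x - P *v x \<in> horth_comp V)"

definition Sigma_sys ::
  "complex set \<Rightarrow> ((complex^'n^'n) \<times> (complex^'n^'n) \<times> (complex^'n^'n) \<times> (complex^'m^'n)) set"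
  where "Sigma_sys K = {(J, R, Q, B).
    entries_in K J \<and> entries_in K R \<and> entries_in K Q \<and> entries_in K B \<and>
    J = - conj_transpose J \<and> hermitian R \<and> psd_over K R \<and> hermitian Q \<and> psd_over K Q}"

definition block33 ::
  "'a^'d^'a1 \<Rightarrow> 'a^'e^'a1 \<Rightarrow> 'a^'f^'a1 \<Rightarrow>
   'a^'d^'a2 \<Rightarrow> 'a^'e^'a2 \<Rightarrow> 'a^'f^'a2 \<Rightarrow>
   'a^'d^'a3 \<Rightarrow> 'a^'e^'a3 \<Rightarrow> 'a^'f^'a3 \<Rightarrow> 'a^('d + 'e + 'f)^('a1 + 'a2 + 'a3)"
  where "block33 A11 A12 A13 A21 A22 A23 A31 A32 A33 = (\<chi> i j.
    case i of
      Inl i1 \<Rightarrow> (case j of Inl j1 \<Rightarrow> A11 $ i1 $ j1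
        | Inr j' \<Rightarrow> (case j' of Inl j2 \<Rightarrow> A12 $ i1 $ j2 | Inr j3 \<Rightarrow> A13 $ i1 $ j3))
    | Inr i' \<Rightarrow> (case i' of
        Inl i2 \<Rightarrow> (case j of Inl j1 \<Rightarrow> A21 $ i2 $ j1
          | Inr j' \<Rightarrow> (case j' of Inl j2 \<Rightarrow> A22 $ i2 $ j2 | Inr j3 \<Rightarrow> A23 $ i2 $ j3))
      | Inr i3 \<Rightarrow> (case j of Inl j1 \<Rightarrow> A31 $ i3 $ j1
          | Inr j' \<Rightarrow> (case j' of Inl j2 \<Rightarrow> A32 $ i3 $ j2 | Inr j3 \<Rightarrow> A33 $ i3 $ j3))))"

definition opt_E :: "complex^('n + 'n + 'm)^('n::finite + 'n + 'm::finite)"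
  where "opt_E = block33
    0       (mat 1) 0
    (- mat 1) 0     0
    0         0     0"

definition opt_A ::
  "complex^'n^'n \<Rightarrow> complex^'n^'n \<Rightarrow> complex^'n^'n \<Rightarrow> complex^'m^'n \<Rightarrow> complex^'m^'m \<Rightarrow>
   complex^('n + 'n + 'm)^('n + 'n + 'm)"
  where "opt_A J R Q B S = block33
    0                               ((J - R) ** Q) B
    (conj_transpose ((J - R) ** Q)) (Q ** R ** Q)  0
    (conj_transpose B)              0              S"

text \<open>The entries \<open>[:- A\<^sub>i\<^sub>j, E\<^sub>i\<^sub>j:]\<close> are those of \<open>s E - A\<close>, as polynomials in \<open>s\<close>.\<close>

definition regular_pencil :: "complex^'k^'k \<Rightarrow> complex^'k^'k \<Rightarrow> bool"
  where "regular_pencil E A \<longleftrightarrow> det (\<chi> i j. [:- (A $ i $ j), E $ i $ j:]) \<noteq> 0"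

text \<open>
  The subspace \<open>B\<^sup>-\<^sup>1 (J Q - z I) ker (R Q)\<close>. Its dimension is constant for all but finitely many \<open>z\<close>
  and minimal there among the \<open>z\<close> that are not eigenvalues of \<open>J Q\<close>. At an eigenvalue it can be
  smaller: for \<open>n = m = 1\<close>, \<open>J = R = 0\<close>, \<open>Q = B = 1\<close> it is 0 at \<open>z = 0\<close> and 1 elsewhere.
\<close>

definition pre_space ::
  "complex^'n^'n \<Rightarrow> complex^'n^'n \<Rightarrow> complex^'n^'n \<Rightarrow> complex^'m^'n \<Rightarrow> complex \<Rightarrow> (complex^'m) set"
  where "pre_space J R Q B z = (\<lambda>u. B *v u) -` ((\<lambda>x. (J ** Q - mat z) *v x) ` mat_ker (R ** Q))"

end

theory Submission
  imports Defs
begin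

text \<open>
  Let \<open>s = \<i> \<omega>\<close> not be an eigenvalue of \<open>J Q\<close>. On the imaginary axis the pencil has enough symmetry
  for an energy argument: a null vector \<open>(p, x, u)\<close> of \<open>s E - A\<^sub>S\<close> satisfies
  \<open>x\<^sup>H Q R Q x + u\<^sup>H S u = 0\<close>, so both dissipation terms vanish, and the null space reduces to
  \<open>V\<^sub>\<omega> \<inter> ker S\<close> with \<open>V\<^sub>\<omega> = B\<^sup>-\<^sup>1 (J Q - \<i> \<omega>) ker (R Q)\<close>. Hence \<open>\<i> \<omega>\<close> is an eigenvalue of the pencil
  exactly if \<open>V\<^sub>\<omega> \<inter> ker S \<noteq> 0\<close> (\<open>pencil_eigenvalue_on_imaginary_axis_iff\<close>). Real weights are covered
  as well, because a real symmetric matrix that is positive semidefinite over the reals is so over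
  the complex numbers (\<open>psd_over_UNIV_if_psd_over_Reals\<close>).

  A pencil is regular as soon as one complex number is not an eigenvalue of it, and then it has
  only finitely many eigenvalues. Since \<open>V\<^sub>\<omega> \<inter> V\<^sub>\<omega>\<^sup>\<bottom> = 0\<close>, a weight \<open>S\<close> with kernel \<open>V\<^sub>\<omega>\<^sup>\<bottom>\<close> is
  regularizing, and its rank is \<open>dim V\<^sub>\<omega>\<close> (\<open>rank_eq_dim\<close>). Conversely, any regularizing weight \<open>T\<close> has
  \<open>V\<^sub>\<omega>\<^sub>' \<inter> ker T = 0\<close> for almost every \<open>\<omega>'\<close>, so that \<open>rank T \<ge> dim V\<^sub>\<omega>\<^sub>'\<close> (\<open>dim_le_rank\<close>). If \<open>dim V\<^sub>\<omega>\<close>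
  is minimal, \<open>S\<close> therefore has minimal rank; it does not matter whether the minimum is taken over
  all \<open>z\<close> or over those outside the spectrum of \<open>J Q\<close>, since both families contain such an \<open>\<i> \<omega>'\<close>.

  That minimality is generic follows from semicontinuity: the dimension of the preimage space
  exceeds its value at a given point outside the spectrum only at finitely many \<open>z\<close>, namely at
  eigenvalues of an auxiliary regular pencil (\<open>finite_dim_pre_space_greater\<close>).
\<close>

section \<open>The Hermitian inner product\<close>

lemma hinner_simps:
  "hinner x 0 = 0" "hinner 0 x = 0" "hinner x (- y) = - hinner x y" "hinner (- x) y = - hinner x y"
  "hinner x (y + z) = hinner x y + hinner x z" "hinner (x + y) z = hinner x z + hinner y z"
  "hinner x (y - z) = hinner x y - hinner x z" "hinner (x - y) z = hinner x z - hinner y z"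
  "hinner x (c *s y) = c * hinner x y" "hinner (c *s x) y = cnj c * hinner x y"
  by (simp_all add: hinner_def algebra_simps sum.distrib sum_subtractf sum_distrib_left sum_negf)

lemma cnj_hinner: "cnj (hinner x y) = hinner y x"
  by (simp add: hinner_def mult.commute)

lemma hinner_conj_transpose: "hinner (conj_transpose A *v x) y = hinner x (A *v y)"
proof -
  have "hinner (conj_transpose A *v x) y = (\<Sum>j\<in>UNIV. \<Sum>i\<in>UNIV. A $ i $ j * cnj (x $ i) * y $ j)"
    by (simp add: hinner_def conj_transpose_def transpose_def matrix_vector_mult_def
        sum_distrib_right)
  also have "\<dots> = (\<Sum>i\<in>UNIV. \<Sum>j\<in>UNIV. A $ i $ j * cnj (x $ i) * y $ j)"
    by (rule sum.swap)
  also have "\<dots> = hinner x (A *v y)"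
    by (simp add: hinner_def matrix_vector_mult_def sum_distrib_left mult_ac)
  finally show ?thesis .
qed

lemma conj_transpose_conj_transpose: "conj_transpose (conj_transpose A) = A"
  by (simp add: conj_transpose_def transpose_def vec_eq_iff)

lemma hinner_self: "hinner x x = of_real ((norm x)\<^sup>2)"
proof -
  have "hinner x x = of_real (\<Sum>i\<in>UNIV. (norm (x $ i))\<^sup>2)"
    by (simp only: hinner_def of_real_sum complex_norm_square mult.commute)
  also have "(\<Sum>i\<in>UNIV. (norm (x $ i))\<^sup>2) = (norm x)\<^sup>2"
    by (simp add: norm_vec_def L2_set_def sum_nonneg)
  finally show ?thesis .
qed

lemma hinner_self_eq_0: "hinner x x = 0 \<longleftrightarrow> x = 0"
  by (simp add: hinner_self)

lemma inner_eq_Re_hinner: "inner x y = Re (hinner x y)" for x y :: "complex^'k"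
  by (simp add: inner_vec_def hinner_def inner_complex_def)

lemma hinner_axis: "hinner (axis i 1) x = x $ i"
proof -
  have "hinner (axis i 1) x = (\<Sum>j\<in>UNIV. if j = i then x $ j else 0)"
    unfolding hinner_def by (intro sum.cong) (auto simp: axis_def)
  then show ?thesis
    by simp
qed

lemma mult_axis: "(A *v axis j 1) $ i = A $ i $ j" for A :: "complex^'c^'r"
proof -
  have "(A *v axis j 1) $ i = (\<Sum>k\<in>UNIV. if k = j then A $ i $ k else 0)"
    by (simp add: matrix_vector_mult_def axis_def if_distrib cong: if_cong)
  then show ?thesis
    by simp
qed

lemma hermitian_iff: "hermitian A \<longleftrightarrow> (\<forall>x y. hinner (A *v x) y = hinner x (A *v y))"
proof
  assume "hermitian A"
  then show "\<forall>x y. hinner (A *v x) y = hinner x (A *v y)"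
    by (metis hermitian_def hinner_conj_transpose)
next
  assume *: "\<forall>x y. hinner (A *v x) y = hinner x (A *v y)"
  have "A $ i $ j = conj_transpose A $ i $ j" for i j
    using *[rule_format, of "axis i 1" "axis j 1"] cnj_hinner[of "axis j 1" "A *v axis i 1"]
    by (simp add: hinner_axis mult_axis conj_transpose_def transpose_def)
  then show "hermitian A"
    unfolding hermitian_def vec_eq_iff by blast
qed

section \<open>Positive semidefinite matrices\<close>

text \<open>
  For a real symmetric \<open>A\<close> the cross terms of \<open>(a + \<i> b)\<^sup>H A (a + \<i> b)\<close> cancel, and
  \<open>a\<^sup>T A a + b\<^sup>T A b\<close> remains.
\<close>

lemma psd_over_UNIV_if_psd_over_Reals:
  assumes "entries_in \<real> A" "hermitian A" "psd_over \<real> A"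
  shows "psd_over UNIV A"
proof -
  have "hinner x (A *v x) \<in> \<real>\<^sub>\<ge>\<^sub>0" for x
  proof -
    define a b :: "complex^'a" where "a = (\<chi> i. of_real (Re (x $ i)))"
      and "b = (\<chi> i. of_real (Im (x $ i)))"
    have x: "x = a + \<i> *s b"
      by (simp add: a_def b_def vec_eq_iff complex_eq_iff)
    have nonneg: "hinner a (A *v a) \<in> \<real>\<^sub>\<ge>\<^sub>0" "hinner b (A *v b) \<in> \<real>\<^sub>\<ge>\<^sub>0"
      using assms(3) by (auto simp: psd_over_def a_def b_def)
    have "hinner a (A *v b) \<in> \<real>"
      using assms(1) unfolding hinner_def matrix_vector_mult_def entries_in_def a_def b_def
      by (auto intro!: sum_in_Reals Reals_mult)
    then have "hinner b (A *v a) = hinner a (A *v b)"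
      using assms(2) cnj_hinner[of a "A *v b"] by (simp add: hermitian_iff Reals_cnj_iff)
    then have "hinner x (A *v x) = hinner a (A *v a) + hinner b (A *v b)"
      by (simp add: x matrix_vector_right_distrib hinner_simps vector_scalar_commute algebra_simps)
    with nonneg show ?thesis
      by simp
  qed
  then show ?thesis
    by (simp add: psd_over_def)
qed

text \<open>
  Moving from \<open>x\<close> in direction \<open>t A x\<close> changes the form by \<open>2 t \<parallel>A x\<parallel>\<^sup>2 + O(t\<^sup>2)\<close>, so a zero of a
  nonnegative form is a zero of \<open>A\<close>.
\<close>

lemma psd_null_vector:
  assumes "hermitian A" "psd_over UNIV A" "hinner x (A *v x) = 0"
  shows "A *v x = 0"
proof -
  define y where "y = A *v x"
  define a where "a = (norm y)\<^sup>2"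
  define c where "c = Re (hinner y (A *v y))"
  have A: "hinner v (A *v v) \<in> \<real>\<^sub>\<ge>\<^sub>0" for v
    using assms(2) by (simp add: psd_over_def)
  have c: "c \<ge> 0"
    using A[of y] by (simp add: c_def complex_nonneg_Reals_iff)
  have xy: "hinner x (A *v y) = of_real a" "hinner y y = of_real a"
    using assms(1)[unfolded hermitian_iff, rule_format, of x y]
    by (simp_all add: a_def y_def hinner_self)
  have nonneg: "0 \<le> 2 * t * a + t\<^sup>2 * c" for t :: real
  proof -
    have eq: "hinner (x + of_real t *s y) (A *v (x + of_real t *s y)) =
        2 * t * a + t\<^sup>2 * hinner y (A *v y)"
    proof -
      have "A *v (x + of_real t *s y) = y + of_real t *s (A *v y)"
        by (simp add: matrix_vector_right_distrib vector_scalar_commute y_def)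
      moreover have "hinner x y = 0"
        using assms(3) by (simp add: y_def)
      ultimately show ?thesis
        using xy by (simp add: hinner_simps power2_eq_square algebra_simps)
    qed
    have "Re (hinner (x + of_real t *s y) (A *v (x + of_real t *s y))) = 2 * t * a + t\<^sup>2 * c"
      unfolding eq by (simp add: c_def power2_eq_square)
    then show ?thesis
      using A[of "x + of_real t *s y"] by (metis complex_nonneg_Reals_iff)
  qed
  define t where "t = - a / (c + 1)"
  have a: "a = - t * (c + 1)"
    using c by (simp add: t_def)
  have "t\<^sup>2 * (c + 2) \<le> 0"
    using nonneg[of t] by (simp add: a power2_eq_square algebra_simps)
  then have "t = 0"
    using c by (simp add: mult_le_0_iff)
  then show ?thesis
    using a by (simp add: a_def y_def)
qed

section \<open>Rank and orthogonal projections\<close>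

lemma dim_cnj_image_le: "vec.dim ((\<lambda>x. \<chi> i. cnj (x $ i)) ` X) \<le> vec.dim X"
  for X :: "(complex^'k) set"
proof -
  define f :: "complex^'k \<Rightarrow> complex^'k" where "f x = (\<chi> i. cnj (x $ i))" for x
  obtain B where B: "B \<subseteq> X" "vec.independent B" "X \<subseteq> vec.span B" "card B = vec.dim X"
    using vec.basis_exists by blast
  have f: "f 0 = 0" "f (x + y) = f x + f y" "f (c *s x) = cnj c *s f x" for x y c
    by (simp_all add: f_def vec_eq_iff)
  have "f x \<in> vec.span (f ` B)" if "x \<in> vec.span B" for x
    using that
    by (induction rule: vec.span_induct_alt)
       (auto simp: f intro: vec.span_zero vec.span_add vec.span_scale vec.span_base)
  then have "vec.dim (f ` X) \<le> card (f ` B)"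
    using B vec.finiteI_independent[OF B(2)] by (intro vec.dim_le_card) auto
  also have "\<dots> \<le> vec.dim X"
    using B vec.finiteI_independent[OF B(2)] by (metis card_image_le)
  finally show ?thesis
    by (simp add: f_def)
qed

text \<open>
  \<open>rank\<close> is the dimension of the row space. The rows of a Hermitian matrix are the entrywise
  conjugates of its columns, and conjugation preserves dimensions.
\<close>

lemma rank_hermitian:
  assumes "hermitian A"
  shows "rank A = vec.dim (range ((*v) A))"
proof -
  let ?f = "\<lambda>x. \<chi> i. cnj (x $ i)"
  have "row i (conj_transpose A) = ?f (column i A)" "column i (conj_transpose A) = ?f (row i A)" for i
    by (simp_all add: conj_transpose_def transpose_def row_def column_def vec_eq_iff)
  then have eq: "row i A = ?f (column i A)" "column i A = ?f (row i A)" for i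
    using assms unfolding hermitian_def by metis+
  have sets: "rows A = range (\<lambda>i. row i A)" "columns A = range (\<lambda>i. column i A)"
    by (auto simp: rows_def columns_def)
  have "rows A = ?f ` columns A" "columns A = ?f ` rows A"
    unfolding sets image_image by (intro image_cong[OF refl] eq)+
  then have "rank A = vec.dim (columns A)"
    unfolding row_rank_def_gen using dim_cnj_image_le by (metis order_antisym)
  also have "column i A = A *v axis i 1" for i
    by (simp add: column_def mult_axis vec_eq_iff)
  then have "columns A \<subseteq> range ((*v) A)"
    unfolding sets by auto
  then have "vec.dim (columns A) = vec.dim (range ((*v) A))"
    by (intro antisym vec.dim_subset vec.dim_mono)
       (auto intro: matrix_vector_mult_in_columnspace_gen)
  finally show ?thesis .
qed

text \<open>A matrix is injective on every subspace that meets its kernel trivially.\<close>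

lemma dim_le_rank:
  assumes "hermitian T" "vec.subspace V" "V \<inter> mat_ker T \<subseteq> {0}"
  shows "vec.dim V \<le> rank T"
proof -
  have "inj_on ((*v) T) V"
  proof (rule inj_onI)
    fix x y
    assume "x \<in> V" "y \<in> V" "T *v x = T *v y"
    then have "x - y \<in> V \<inter> mat_ker T"
      using assms(2) by (simp add: vec.subspace_diff mat_ker_def matrix_vector_mult_diff_distrib)
    with assms(3) show "x = y"
      by auto
  qed
  then have "vec.dim V = vec.dim ((*v) T ` V)"
    using assms(2) by (intro vec.dim_image_eq[symmetric]) (auto simp: vec.span_eq_iff[THEN iffD2])
  also have "\<dots> \<le> rank T"
    unfolding rank_hermitian[OF assms(1)] by (intro vec.dim_subset) auto
  finally show ?thesis .
qed

lemma subspace_horth_comp: "vec.subspace (horth_comp V)"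
  by (auto simp: vec.subspace_def horth_comp_def hinner_simps)

lemma horth_comp_Int: "x \<in> V \<Longrightarrow> x \<in> horth_comp V \<Longrightarrow> x = 0"
  by (auto simp: horth_comp_def simp flip: hinner_self_eq_0)

text \<open>
  For a complex subspace, real and Hermitian orthogonality agree, so the decomposition with respect
  to the real inner product also serves here. Its uniqueness makes it complex linear.
\<close>

lemma orth_projection_exists:
  assumes V: "vec.subspace V"
  obtains P where "is_orth_projection P V"
proof -
  have decomp: "\<exists>a. a \<in> V \<and> x - a \<in> horth_comp V" for x
  proof -
    have "(r::real) *\<^sub>R w = of_real r *s w" for r and w :: "complex^'a"
      by (simp add: vec_eq_iff scaleR_conv_of_real[where 'a = complex])
    then have "subspace V"
      using V by (simp add: vec.subspace_def subspace_def)
    then obtain a z where a: "a \<in> V" and z: "\<And>w. w \<in> V \<Longrightarrow> orthogonal z w" and x: "x = a + z"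
      using orthogonal_subspace_decomp_exists[of V x] by (metis span_eq_iff)
    have "hinner w z = 0" if "w \<in> V" for w
    proof -
      \<comment> \<open>The real inner product sees the imaginary part of \<open>hinner w z\<close> through \<open>\<i> w \<in> V\<close>.\<close>
      have "orthogonal z w" "orthogonal z (\<i> *s w)"
        using z that V by (auto simp: vec.subspace_scale)
      then have "Re (hinner z w) = 0" "Im (hinner z w) = 0"
        by (simp_all add: orthogonal_def inner_eq_Re_hinner hinner_simps)
      then have "hinner z w = 0"
        by (simp add: complex_eq_iff)
      then show ?thesis
        using cnj_hinner[of z w] by simp
    qed
    with a x show ?thesis
      by (intro exI[of _ a]) (simp add: horth_comp_def)
  qed
  then obtain f where f: "\<And>x. f x \<in> V" "\<And>x. x - f x \<in> horth_comp V"
    by metis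
  have unique: "f x = a" if "a \<in> V" "x - a \<in> horth_comp V" for x a
  proof -
    have "(x - a) - (x - f x) \<in> horth_comp V"
      by (rule vec.subspace_diff[OF subspace_horth_comp that(2) f(2)])
    moreover have "f x - a \<in> V"
      by (rule vec.subspace_diff[OF V f(1) that(1)])
    ultimately show ?thesis
      using horth_comp_Int[of "f x - a" V] by simp
  qed
  have "Vector_Spaces.linear (*s) (*s) f"
  proof unfold_locales
    fix x y :: "complex^'a" and c :: complex
    have "(x - f x) + (y - f y) \<in> horth_comp V" "c *s (x - f x) \<in> horth_comp V"
      by (intro f vec.subspace_add vec.subspace_scale subspace_horth_comp)+
    then show "f (x + y) = f x + f y" "f (c *s x) = c *s f x"
      using f V
      by (auto intro!: unique vec.subspace_add vec.subspace_scale simp: algebra_simps vec.scale_right_diff_distrib)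
  qed
  then have "is_orth_projection (matrix f) V"
    using f by (simp add: is_orth_projection_def matrix_works)
  then show thesis
    by (rule that)
qed

lemma
  assumes V: "vec.subspace V" and P: "is_orth_projection P V"
  shows hermitian_orth_projection: "hermitian P"
    and psd_orth_projection: "psd_over UNIV P"
    and mat_ker_orth_projection: "mat_ker P = horth_comp V"
proof -
  have P': "P *v x \<in> V" "x - P *v x \<in> horth_comp V" for x
    using P by (auto simp: is_orth_projection_def)
  have "hinner (P *v x) (y - P *v y) = 0" for x y
    using P' by (auto simp: horth_comp_def)
  then have r: "hinner (P *v x) y = hinner (P *v x) (P *v y)" for x y
    by (simp add: hinner_simps)
  then have l: "hinner x (P *v y) = hinner (P *v x) (P *v y)" for x y
    by (metis cnj_hinner)
  show "hermitian P"
    using r l by (simp add: hermitian_iff)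
  have "hinner x (P *v x) \<in> \<real>\<^sub>\<ge>\<^sub>0" for x
    unfolding l[of x x] by (simp add: hinner_self)
  then show "psd_over UNIV P"
    by (simp add: psd_over_def)
  show "mat_ker P = horth_comp V"
  proof (intro set_eqI iffI)
    fix x
    assume "x \<in> mat_ker P"
    then show "x \<in> horth_comp V"
      using P'(2)[of x] by (simp add: mat_ker_def)
  next
    fix x
    assume "x \<in> horth_comp V"
    then have "P *v x \<in> horth_comp V"
      using P'(2)[of x] vec.subspace_diff[OF subspace_horth_comp, of x V "x - P *v x"] by simp
    then show "x \<in> mat_ker P"
      using P'(1) horth_comp_Int by (auto simp: mat_ker_def)
  qed
qed

text \<open>
  Since \<open>S\<close> vanishes exactly on \<open>V\<^sup>\<bottom>\<close>, a complement of \<open>V\<close>, the range of \<open>S\<close> is the injective image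
  of \<open>V\<close>.
\<close>

lemma rank_eq_dim:
  assumes "vec.subspace V" "hermitian S" "mat_ker S = horth_comp V"
  shows "rank S = vec.dim V"
proof (rule antisym)
  obtain P where P: "is_orth_projection P V"
    using orth_projection_exists assms(1) .
  have "S *v x = S *v (P *v x)" for x
  proof -
    have "x - P *v x \<in> mat_ker S"
      using P assms(3) by (simp add: is_orth_projection_def)
    then show ?thesis
      by (simp add: mat_ker_def matrix_vector_mult_diff_distrib)
  qed
  then have "range ((*v) S) \<subseteq> (*v) S ` V"
    using P by (auto simp: is_orth_projection_def)
  then have "rank S \<le> vec.dim ((*v) S ` V)"
    unfolding rank_hermitian[OF assms(2)] by (rule vec.dim_subset)
  also have "\<dots> \<le> vec.dim V"
    by (rule vec.dim_image_le) simp
  finally show "rank S \<le> vec.dim V" .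
  show "vec.dim V \<le> rank S"
    using assms horth_comp_Int by (intro dim_le_rank) auto
qed

section \<open>Matrix pencils\<close>

definition pencil_eigenvalues :: "complex^'k^'k \<Rightarrow> complex^'k^'k \<Rightarrow> complex set"
  where "pencil_eigenvalues E A = {s. \<exists>v. v \<noteq> 0 \<and> A *v v = s *s (E *v v)}"

lemma eigenvalues_eq: "eigenvalues A = pencil_eigenvalues (mat 1) A"
  by (simp add: eigenvalues_def pencil_eigenvalues_def)

lemma poly_det_pencil_eq_0:
  "poly (det (\<chi> i j. [:- (A $ i $ j), E $ i $ j:])) s = 0 \<longleftrightarrow> s \<in> pencil_eigenvalues E A"
proof -
  let ?M = "(\<chi> i j. s * E $ i $ j - A $ i $ j)"
  have "poly (det (\<chi> i j. [:- (A $ i $ j), E $ i $ j:])) s = det ?M"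
    by (simp add: det_def poly_sum poly_prod sign_def)
  moreover have "det N \<noteq> 0 \<longleftrightarrow> (\<forall>v. N *v v = 0 \<longrightarrow> v = 0)" for N :: "complex^'a^'a"
    unfolding invertible_det_nz[symmetric] invertible_left_inverse matrix_left_invertible_ker ..
  then have "det ?M = 0 \<longleftrightarrow> (\<exists>v. v \<noteq> 0 \<and> ?M *v v = 0)"
    by blast
  moreover have "?M *v v = s *s (E *v v) - A *v v" for v
    by (simp add: vec_eq_iff matrix_vector_mult_def sum_distrib_left algebra_simps sum_subtractf)
  ultimately show ?thesis
    by (auto simp: pencil_eigenvalues_def)
qed

lemma regular_pencil_iff: "regular_pencil E A \<longleftrightarrow> pencil_eigenvalues E A \<noteq> UNIV"
  unfolding regular_pencil_def poly_all_0_iff_0[symmetric] poly_det_pencil_eq_0 by auto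

lemma finite_pencil_eigenvalues: "regular_pencil E A \<Longrightarrow> finite (pencil_eigenvalues E A)"
  unfolding regular_pencil_def by (drule poly_roots_finite) (simp add: poly_det_pencil_eq_0)

definition vec3 :: "'a^'d \<Rightarrow> 'a^'e \<Rightarrow> 'a^'f \<Rightarrow> 'a^('d + 'e + 'f)"
  where "vec3 p x u = (\<chi> i. case i of Inl i1 \<Rightarrow> p $ i1
    | Inr i' \<Rightarrow> (case i' of Inl i2 \<Rightarrow> x $ i2 | Inr i3 \<Rightarrow> u $ i3))"

lemma vec3_eq_iff: "vec3 p x u = vec3 p' x' u' \<longleftrightarrow> p = p' \<and> x = x' \<and> u = u'"
  by (auto simp: vec3_def vec_eq_iff split: sum.splits)

lemma vec3_eq_0_iff: "vec3 p x u = 0 \<longleftrightarrow> p = 0 \<and> x = 0 \<and> u = 0"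
  by (auto simp: vec3_def vec_eq_iff split: sum.splits)

lemma scale_vec3: "c *s vec3 p x u = vec3 (c *s p) (c *s x) (c *s u)"
  by (auto simp: vec3_def vec_eq_iff split: sum.splits)

lemma ex_vec3: "(\<exists>v. F v) \<longleftrightarrow> (\<exists>p x u. F (vec3 p x u))"
proof -
  have "v = vec3 (\<chi> i. v $ Inl i) (\<chi> i. v $ Inr (Inl i)) (\<chi> i. v $ Inr (Inr i))" for v :: "'a^('b + 'c + 'd)"
    by (auto simp: vec3_def vec_eq_iff split: sum.splits)
  then show ?thesis
    by metis
qed

lemma sum_UNIV_sum_type:
  "(\<Sum>i\<in>UNIV. g i) = (\<Sum>i\<in>UNIV. g (Inl i)) + (\<Sum>i\<in>UNIV. g (Inr i))"
  for g :: "'x::finite + 'y::finite \<Rightarrow> 'z::comm_monoid_add"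
  using sum.Plus[of "UNIV :: 'x set" "UNIV :: 'y set" g] by simp

lemma block33_mult_vec3:
  "block33 A11 A12 A13 A21 A22 A23 A31 A32 A33 *v vec3 p x u =
     vec3 (A11 *v p + A12 *v x + A13 *v u) (A21 *v p + A22 *v x + A23 *v u)
       (A31 *v p + A32 *v x + A33 *v u)"
  by (auto simp: block33_def vec3_def vec_eq_iff matrix_vector_mult_def sum_UNIV_sum_type add.assoc
      split: sum.splits)

lemma minus_mult_vec: "(- A) *v x = - (A *v x)" "A *v (- x) = - (A *v x)"
  for A :: "'a::ring_1^'c^'r"
  by (simp_all add: matrix_vector_mult_def vec_eq_iff sum_negf)

section \<open>The optimality pencil on the imaginary axis\<close>

lemma subspace_pre_space: "vec.subspace (pre_space J R Q B z)"
proof -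
  have "vec.subspace (mat_ker (R ** Q))"
    by (auto simp: vec.subspace_def mat_ker_def matrix_vector_right_distrib vector_scalar_commute)
  then show ?thesis
    unfolding pre_space_def
    by (intro vec.subspace_vimage vec.subspace_image) auto
qed

lemma mat_mult_vec: "mat c *v x = c *s x"
  by (simp add: mat_def matrix_vector_mult_def vec_eq_iff if_distrib[of "\<lambda>c. c * _"] cong: if_cong)

lemma in_pre_space_iff:
  "u \<in> pre_space J R Q B z \<longleftrightarrow> (\<exists>x. (R ** Q) *v x = 0 \<and> (J ** Q) *v x - z *s x = B *v u)"
proof -
  have "(J ** Q - mat z) *v x = (J ** Q) *v x - z *s x" for x
    by (simp add: matrix_vector_mult_diff_rdistrib mat_mult_vec)
  then show ?thesis
    unfolding pre_space_def vimage_def mat_ker_def image_iff Bex_def mem_Collect_eq by metis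
qed

text \<open>
  On the imaginary axis \<open>- s = cnj s\<close>, so that the first two block rows of the pencil carry
  \<open>s - M\<close> and its adjoint, where \<open>M = (J - R) Q\<close>. Evaluating \<open>p\<^sup>H (s - M) x\<close> in two ways for
  a null vector \<open>(p, x, u)\<close> then yields \<open>x\<^sup>H Q R Q x + u\<^sup>H S u = 0\<close>. Both summands are nonnegative, hence \<open>R Q x = 0\<close> and
  \<open>S u = 0\<close>: \<open>u\<close> lies in the preimage space and in \<open>ker S\<close>. Moreover \<open>u = 0\<close> forces \<open>x = 0\<close> and
  \<open>p = 0\<close>, because \<open>M - s\<close> is invertible: if \<open>M x = s x\<close>, then the real part of
  \<open>(Q x)\<^sup>H M x = s x\<^sup>H Q x\<close> shows \<open>R Q x = 0\<close>, so that \<open>J Q x = s x\<close> and \<open>x = 0\<close>.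
\<close>

lemma pencil_eigenvalue_on_imaginary_axis_iff:
  fixes J R Q :: "complex^'n^'n" and B :: "complex^'m^'n" and S :: "complex^'m^'m"
  assumes J: "J = - conj_transpose J" and R: "hermitian R" "psd_over UNIV R" and Q: "hermitian Q"
    and S: "hermitian S" "psd_over UNIV S"
    and s: "cnj s = - s" "s \<notin> eigenvalues (J ** Q)"
  shows "s \<in> pencil_eigenvalues opt_E (opt_A J R Q B S) \<longleftrightarrow>
    \<not> pre_space J R Q B s \<inter> mat_ker S \<subseteq> {0}"
proof -
  define M where "M = (J - R) ** Q"
  have M: "M *v x = J *v (Q *v x) - R *v (Q *v x)" for x
    by (simp add: M_def matrix_vector_mul_assoc[symmetric] matrix_vector_mult_diff_rdistrib)
  have null: "opt_A J R Q B S *v vec3 p x u = s *s (opt_E *v vec3 p x u) \<longleftrightarrow>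
      M *v x + B *v u = s *s x \<and> conj_transpose M *v p + Q *v (R *v (Q *v x)) = - (s *s p) \<and>
      conj_transpose B *v p + S *v u = 0" for p x u
    by (simp add: opt_A_def opt_E_def block33_mult_vec3 scale_vec3 vec3_eq_iff M_def
        minus_mult_vec matrix_vector_mul_assoc matrix_mul_assoc)
  have Q': "hinner (Q *v x) y = hinner x (Q *v y)" for x y
    using Q by (simp add: hermitian_iff)
  have R_null: "R *v x = 0" if "hinner x (R *v x) = 0" for x
    using psd_null_vector R that .
  have JQ_null: "x = 0" if "J *v (Q *v x) = s *s x" for x
    using s(2) that by (auto simp: eigenvalues_def matrix_vector_mul_assoc)
  have inj: "x = 0" if "M *v x = s *s x" for x
  proof -
    define y where "y = Q *v x"
    have "hinner y (J *v y) = - cnj (hinner y (J *v y))"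
    proof -
      have "hinner y (J *v y) = hinner (conj_transpose J *v y) y"
        by (simp add: hinner_conj_transpose)
      also have "conj_transpose J = - J"
        using J by (metis minus_minus)
      also have "hinner (- J *v y) y = - hinner (J *v y) y"
        by (simp add: hinner_simps minus_mult_vec)
      finally show ?thesis
        by (simp add: cnj_hinner)
    qed
    then have "Re (hinner y (J *v y)) = 0"
      by (simp add: complex_eq_iff)
    moreover have "Re (hinner y (s *s x)) = 0"
    proof -
      have "hinner y x = cnj (hinner y x)"
        by (simp add: cnj_hinner y_def Q')
      then show ?thesis
        using s(1) by (simp add: hinner_simps complex_eq_iff)
    qed
    moreover have "hinner y (J *v y) - hinner y (R *v y) = hinner y (s *s x)"
      using that by (simp add: M y_def flip: hinner_simps)
    ultimately have "Re (hinner y (R *v y)) = 0"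
      by (metis diff_zero minus_complex.sel(1) neg_equal_zero zero_diff diff_0 minus_equation_iff)
    moreover have "hinner y (R *v y) \<in> \<real>\<^sub>\<ge>\<^sub>0"
      using R(2) by (simp add: psd_over_def)
    ultimately have "R *v y = 0"
      by (intro R_null) (auto simp: complex_nonneg_Reals_iff complex_eq_iff)
    with that show ?thesis
      by (intro JQ_null) (simp add: M y_def)
  qed
  show ?thesis
  proof
    assume "s \<in> pencil_eigenvalues opt_E (opt_A J R Q B S)"
    then obtain p x u where nz: "vec3 p x u \<noteq> 0"
      and "opt_A J R Q B S *v vec3 p x u = s *s (opt_E *v vec3 p x u)"
      unfolding pencil_eigenvalues_def mem_Collect_eq by (subst (asm) ex_vec3) blast
    then have 1: "B *v u = s *s x - M *v x"
      and 2: "conj_transpose M *v p = - (s *s p) - Q *v (R *v (Q *v x))"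
      and 3: "conj_transpose B *v p = - (S *v u)"
      unfolding null by (auto simp: algebra_simps eq_neg_iff_add_eq_0)
    have "hinner p (B *v u) = - hinner u (S *v u)"
      using S(1) by (simp add: 3 hinner_simps hermitian_iff flip: hinner_conj_transpose)
    moreover have "hinner p (B *v u) = hinner (Q *v x) (R *v (Q *v x))"
    proof -
      have "hinner p (B *v u) = s * hinner p x - hinner (conj_transpose M *v p) x"
        by (simp add: 1 hinner_simps hinner_conj_transpose)
      also have "\<dots> = hinner (Q *v (R *v (Q *v x))) x"
        using s(1) by (simp add: 2 hinner_simps)
      also have "\<dots> = hinner (Q *v x) (R *v (Q *v x))"
        using R(1) by (simp add: Q' hermitian_iff)
      finally show ?thesis .
    qed
    moreover have "hinner u (S *v u) \<in> \<real>\<^sub>\<ge>\<^sub>0" "hinner (Q *v x) (R *v (Q *v x)) \<in> \<real>\<^sub>\<ge>\<^sub>0"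
      using R(2) S(2) by (auto simp: psd_over_def)
    ultimately have "hinner u (S *v u) = 0" "hinner (Q *v x) (R *v (Q *v x)) = 0"
      by (auto simp: complex_nonneg_Reals_iff complex_eq_iff)
    then have Su: "S *v u = 0" and RQx: "R *v (Q *v x) = 0"
      using psd_null_vector S R_null by auto
    have "u \<in> pre_space J R Q B s"
      using RQx 1 unfolding in_pre_space_iff
      by (intro exI[of _ "- x"]) (simp add: M minus_mult_vec flip: matrix_vector_mul_assoc)
    moreover have "u \<noteq> 0"
    proof
      assume "u = 0"
      then have x: "x = 0"
        using 1 by (intro inj) simp
      have "inj ((*v) (M - mat s))"
        using inj by (auto simp: vec.inj_iff_eq_0 matrix_vector_mult_diff_rdistrib mat_mult_vec)
      then have "surj ((*v) (M - mat s))"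
        by (intro vec.linear_inj_imp_surj) auto
      then obtain y where y: "p = M *v y - s *s y"
        by (metis matrix_vector_mult_diff_rdistrib mat_mult_vec surjD)
      have "hinner p p = hinner (conj_transpose M *v p) y - s * hinner p y"
        by (subst (2) y) (simp add: hinner_simps hinner_conj_transpose)
      also have "\<dots> = 0"
        using s(1) by (simp add: 2 x hinner_simps)
      finally have "p = 0"
        by (simp add: hinner_self_eq_0)
      with nz x \<open>u = 0\<close> show False
        by (simp add: vec3_eq_0_iff)
    qed
    ultimately show "\<not> pre_space J R Q B s \<inter> mat_ker S \<subseteq> {0}"
      using Su by (auto simp: mat_ker_def)
  next
    assume "\<not> pre_space J R Q B s \<inter> mat_ker S \<subseteq> {0}"
    then obtain u where u: "u \<noteq> 0" "S *v u = 0" and "u \<in> pre_space J R Q B s"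
      by (auto simp: mat_ker_def)
    then obtain x where x: "R *v (Q *v x) = 0" "J *v (Q *v x) - s *s x = B *v u"
      by (auto simp: in_pre_space_iff simp flip: matrix_vector_mul_assoc)
    have "M *v (- x) + B *v u = s *s (- x)"
      unfolding x(2)[symmetric] using x(1) by (simp add: M minus_mult_vec)
    then have "opt_A J R Q B S *v vec3 0 (- x) u = s *s (opt_E *v vec3 0 (- x) u)"
      unfolding null using u(2) x(1) by (simp add: minus_mult_vec)
    then show "s \<in> pencil_eigenvalues opt_E (opt_A J R Q B S)"
      using u(1) unfolding pencil_eigenvalues_def
      by (auto simp: vec3_eq_0_iff intro!: exI[of _ "vec3 0 (- x) u"])
  qed
qed

section \<open>The dimension of the preimage space\<close>

text \<open>
  The idea is to exhibit the exceptional \<open>z\<close> as eigenvalues of a regular pencil. Let \<open>N\<close> be the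
  inverse of \<open>J Q - z0\<close>, \<open>G = R Q N B\<close> and \<open>P\<close> the orthogonal projection onto the preimage space at
  \<open>z0\<close>, which is \<open>ker G\<close>. The pencil below has the null vector equations \<open>w = R Q x\<close>,
  \<open>(J Q - z) x = B u\<close> and \<open>G\<^sup>H w + P u = 0\<close>. At \<open>z = z0\<close> they give \<open>(G\<^sup>H G + P) u = 0\<close>, whence
  \<open>u \<in> ker G \<inter> ker P = {0}\<close>, so the pencil is regular. Conversely, for every \<open>z\<close>, a vector of the
  preimage space at \<open>z\<close> on which \<open>P\<close> vanishes solves the equations with \<open>w = 0\<close>. Thus, outside
  the finitely many eigenvalues of the pencil, \<open>P\<close> is injective on the preimage space at \<open>z\<close>, whose
  dimension is then at most \<open>rank P\<close>, the dimension at \<open>z0\<close>.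
\<close>

lemma finite_dim_pre_space_greater:
  fixes J R Q :: "complex^'n^'n" and B :: "complex^'m^'n"
  assumes z0: "z0 \<notin> eigenvalues (J ** Q)"
  shows "finite {z. vec.dim (pre_space J R Q B z0) < vec.dim (pre_space J R Q B z)}"
proof -
  let ?V = "pre_space J R Q B"
  obtain P where P: "is_orth_projection P (?V z0)"
    using orth_projection_exists subspace_pre_space .
  note P' = hermitian_orth_projection[OF subspace_pre_space P]
    psd_orth_projection[OF subspace_pre_space P] mat_ker_orth_projection[OF subspace_pre_space P]
  have JQ_null: "x = 0" if "(J ** Q) *v x = z0 *s x" for x
    using z0 that by (auto simp: eigenvalues_def)
  then have "inj ((*v) (J ** Q - mat z0))"
    by (auto simp: vec.inj_iff_eq_0 matrix_vector_mult_diff_rdistrib mat_mult_vec)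
  then obtain N where N: "N ** (J ** Q - mat z0) = mat 1"
    using matrix_left_invertible_injective by blast
  define G where "G = (R ** Q) ** (N ** B)"
  define E :: "complex^('n + 'n + 'm)^('n + 'n + 'm)"
    where "E = block33 0 0 0 0 (mat 1) 0 0 0 0"
  define A :: "complex^('n + 'n + 'm)^('n + 'n + 'm)"
    where "A = block33 (mat 1) (- (R ** Q)) 0 0 (J ** Q) (- B) (conj_transpose G) 0 P"
  have null: "A *v vec3 w x u = z *s (E *v vec3 w x u) \<longleftrightarrow>
      w = (R ** Q) *v x \<and> (J ** Q) *v x - z *s x = B *v u \<and> conj_transpose G *v w + P *v u = 0"
    for w x u z
    by (auto simp: A_def E_def block33_mult_vec3 scale_vec3 vec3_eq_iff minus_mult_vec
        algebra_simps)
  have "z0 \<notin> pencil_eigenvalues E A"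
  proof
    assume "z0 \<in> pencil_eigenvalues E A"
    then obtain w x u where nz: "vec3 w x u \<noteq> 0" and "A *v vec3 w x u = z0 *s (E *v vec3 w x u)"
      unfolding pencil_eigenvalues_def mem_Collect_eq by (subst (asm) ex_vec3) blast
    then have w: "w = (R ** Q) *v x" and x: "(J ** Q) *v x - z0 *s x = B *v u"
      and u: "conj_transpose G *v w + P *v u = 0"
      unfolding null by auto
    have "x = (N ** (J ** Q - mat z0)) *v x"
      by (simp add: N)
    also have "\<dots> = N *v (B *v u)"
      by (simp only: matrix_vector_mul_assoc[symmetric] matrix_vector_mult_diff_rdistrib mat_mult_vec flip: x)
    finally have wG: "w = G *v u"
      by (simp add: w G_def matrix_vector_mul_assoc matrix_mul_assoc)
    have "hinner u (conj_transpose G *v w) + hinner u (P *v u) = 0"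
      using u by (simp add: hinner_simps(1) flip: hinner_simps(5))
    moreover have "hinner u (conj_transpose G *v w) = hinner w w"
      using hinner_conj_transpose[of "conj_transpose G" u w] by (simp add: wG conj_transpose_conj_transpose)
    moreover have "hinner u (P *v u) \<in> \<real>\<^sub>\<ge>\<^sub>0"
      using P'(2) by (simp add: psd_over_def)
    ultimately have "hinner w w = 0" "hinner u (P *v u) = 0"
      by (auto simp: hinner_self complex_nonneg_Reals_iff complex_eq_iff add_nonneg_eq_0_iff)
    then have w0: "w = 0" and "P *v u = 0"
      using psd_null_vector P' by (auto simp: hinner_self_eq_0)
    moreover have "u \<in> ?V z0"
      using w w0 x by (auto simp: in_pre_space_iff)
    ultimately have "u = 0"
      using P'(3) horth_comp_Int by (auto simp: mat_ker_def)
    moreover from this have "x = 0"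
      using x by (intro JQ_null) simp
    ultimately show False
      using nz w0 by (simp add: vec3_eq_0_iff)
  qed
  then have "finite (pencil_eigenvalues E A)"
    by (intro finite_pencil_eigenvalues) (auto simp: regular_pencil_iff)
  moreover have "vec.dim (?V z) \<le> vec.dim (?V z0)" if z: "z \<notin> pencil_eigenvalues E A" for z
  proof -
    have "?V z \<inter> mat_ker P \<subseteq> {0}"
    proof
      fix u
      assume "u \<in> ?V z \<inter> mat_ker P"
      then obtain x where "A *v vec3 0 x u = z *s (E *v vec3 0 x u)"
        unfolding null by (auto simp: in_pre_space_iff mat_ker_def)
      with z have "vec3 0 x u = (0 :: complex^('n + 'n + 'm))"
        unfolding pencil_eigenvalues_def by blast
      then show "u \<in> {0}"
        by (simp add: vec3_eq_0_iff)
    qed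
    then have "vec.dim (?V z) \<le> rank P"
      by (intro dim_le_rank P' subspace_pre_space)
    also have "\<dots> = vec.dim (?V z0)"
      by (intro rank_eq_dim P' subspace_pre_space)
    finally show ?thesis .
  qed
  then have "{z. vec.dim (?V z0) < vec.dim (?V z)} \<subseteq> pencil_eigenvalues E A"
    by (auto simp: not_less[symmetric])
  ultimately show ?thesis
    by (rule finite_subset[rotated])
qed

section \<open>Minimal regularizing weights\<close>

lemma finite_imaginary_part:
  assumes "finite F"
  shows "finite {\<omega>::real. \<i> * of_real \<omega> \<in> F}"
  using finite_vimageI[OF assms, of "\<lambda>\<omega>::real. \<i> * of_real \<omega>"]
  by (simp add: inj_def vimage_def)

lemma finite_dims: "finite {vec.dim (X z :: (complex^'k) set) | z. F z}"
  by (rule finite_subset[of _ "{..CARD('k)}"]) (auto intro: dim_subset_UNIV_cart_gen)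

lemma finite_ranks: "finite {rank (T :: complex^'k^'k) | T. F T}"
  unfolding row_rank_def_gen by (rule finite_dims)

theorem lemma3p7:
  fixes K :: "complex set"
    and J R Q :: "complex^'n^'n"
    and B :: "complex^'m^'n"
  assumes "K = \<real> \<or> K = UNIV"
    and "CARD('m) \<le> CARD('n)"
    and "(J, R, Q, B) \<in> Sigma_sys K"
    and "\<not> regular_pencil opt_E (opt_A J R Q B 0)"
  shows "(\<forall>\<omega>::real. \<i> * of_real \<omega> \<notin> eigenvalues (J ** Q) \<longrightarrow>
            (let V = pre_space J R Q B (\<i> * of_real \<omega>) in
              (\<forall>S. entries_in K S \<and> hermitian S \<and> psd_over K S \<and> mat_ker S = horth_comp V \<longrightarrow>
                 regular_pencil opt_E (opt_A J R Q B S) \<and>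
                 (vec.dim V = Min {vec.dim (pre_space J R Q B z) | z. z \<in> UNIV} \<longrightarrow>
                    rank S = Min {rank T | T. entries_in K T \<and> hermitian T \<and> psd_over K T \<and>
                                              regular_pencil opt_E (opt_A J R Q B T)}) \<and>
                 (vec.dim V = Min {vec.dim (pre_space J R Q B z) | z. z \<notin> eigenvalues (J ** Q)} \<longrightarrow>
                    rank S = Min {rank T | T. entries_in K T \<and> hermitian T \<and> psd_over K T \<and>
                                              regular_pencil opt_E (opt_A J R Q B T)})) \<and>
              (\<exists>P. is_orth_projection P V \<and> hermitian P \<and> psd_over UNIV P \<and>
                   mat_ker P = horth_comp V))) \<and>
         finite {\<omega>::real. \<i> * of_real \<omega> \<notin> eigenvalues (J ** Q) \<and>
                   vec.dim (pre_space J R Q B (\<i> * of_real \<omega>)) \<noteq>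
                   Min {vec.dim (pre_space J R Q B z) | z. z \<notin> eigenvalues (J ** Q)}}"
proof -
  let ?\<sigma> = "eigenvalues (J ** Q)"
  let ?V = "\<lambda>z. pre_space J R Q B z"
  have psd: "psd_over UNIV A" if "entries_in K A" "hermitian A" "psd_over K A"
    for A :: "complex^'k^'k"
    using assms(1) that psd_over_UNIV_if_psd_over_Reals by auto
  have J: "J = - conj_transpose J" and R: "hermitian R" "psd_over UNIV R" and Q: "hermitian Q"
    using assms(3) psd by (auto simp: Sigma_sys_def)
  let ?regular = "\<lambda>T. regular_pencil opt_E (opt_A J R Q B T)"
  let ?weights = "{T. entries_in K T \<and> hermitian T \<and> psd_over K T \<and> ?regular T}"
  have eigenvalue_iff: "\<i> * of_real \<omega> \<in> pencil_eigenvalues opt_E (opt_A J R Q B T) \<longleftrightarrow>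
      \<not> ?V (\<i> * of_real \<omega>) \<inter> mat_ker T \<subseteq> {0}"
    if "entries_in K T" "hermitian T" "psd_over K T" "\<i> * of_real \<omega> \<notin> ?\<sigma>" for \<omega> T
    using that psd by (intro pencil_eigenvalue_on_imaginary_axis_iff J R Q) auto
  have finite_\<sigma>: "finite ?\<sigma>" if "z \<notin> ?\<sigma>" for z
    using that unfolding eigenvalues_eq
    by (intro finite_pencil_eigenvalues) (auto simp: regular_pencil_iff)
  \<comment> \<open>A regularizing weight is injective on the preimage space at almost every imaginary point.\<close>
  have lower: "\<exists>\<omega>'. \<i> * of_real \<omega>' \<notin> ?\<sigma> \<and> vec.dim (?V (\<i> * of_real \<omega>')) \<le> rank T"
    if "T \<in> ?weights" "\<i> * of_real \<omega> \<notin> ?\<sigma>" for T and \<omega> :: real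
  proof -
    have "finite (?\<sigma> \<union> pencil_eigenvalues opt_E (opt_A J R Q B T))"
      using that finite_\<sigma> finite_pencil_eigenvalues by blast
    then obtain \<omega>' where
      "\<i> * of_real \<omega>' \<notin> ?\<sigma> \<union> pencil_eigenvalues opt_E (opt_A J R Q B T)"
      using ex_new_if_finite[OF infinite_UNIV_char_0 finite_imaginary_part] by blast
    then show ?thesis
      using that eigenvalue_iff[of T \<omega>'] by (auto intro!: exI[of _ \<omega>'] dim_le_rank subspace_pre_space)
  qed
  have weight: "?regular S \<and>
      (vec.dim (?V (\<i> * of_real \<omega>)) = Min {vec.dim (?V z) | z. z \<in> Z} \<longrightarrow>
        rank S = Min {rank T | T. T \<in> ?weights})"
    if \<omega>: "\<i> * of_real \<omega> \<notin> ?\<sigma>" and S: "entries_in K S" "hermitian S" "psd_over K S"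
      "mat_ker S = horth_comp (?V (\<i> * of_real \<omega>))" and Z: "- ?\<sigma> \<subseteq> Z" for \<omega> S Z
  proof (intro conjI impI)
    have "?V (\<i> * of_real \<omega>) \<inter> mat_ker S \<subseteq> {0}"
      using S(4) horth_comp_Int by blast
    then show reg: "?regular S"
      unfolding regular_pencil_iff using eigenvalue_iff[of S \<omega>] S \<omega> by auto
    assume min: "vec.dim (?V (\<i> * of_real \<omega>)) = Min {vec.dim (?V z) | z. z \<in> Z}"
    have rank_S: "rank S = vec.dim (?V (\<i> * of_real \<omega>))"
      using S by (intro rank_eq_dim subspace_pre_space)
    have "rank S \<le> rank T" if "T \<in> ?weights" for T
    proof -
      obtain \<omega>' where \<omega>': "\<i> * of_real \<omega>' \<in> Z" "vec.dim (?V (\<i> * of_real \<omega>')) \<le> rank T"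
        using lower[OF \<open>T \<in> ?weights\<close> \<omega>] Z by blast
      have "rank S \<le> vec.dim (?V (\<i> * of_real \<omega>'))"
        unfolding rank_S min using \<omega>'(1) by (intro Min_le finite_dims) auto
      with \<omega>'(2) show ?thesis
        by simp
    qed
    moreover have "S \<in> ?weights"
      using S reg by simp
    ultimately show "rank S = Min {rank T | T. T \<in> ?weights}"
      by (intro Min_eqI[symmetric] finite_ranks) auto
  qed
  have projection: "\<exists>P. is_orth_projection P (?V z) \<and> hermitian P \<and> psd_over UNIV P \<and>
      mat_ker P = horth_comp (?V z)" for z
    using orth_projection_exists[OF subspace_pre_space] hermitian_orth_projection[OF subspace_pre_space]
      psd_orth_projection[OF subspace_pre_space] mat_ker_orth_projection[OF subspace_pre_space]
    by metis
  have generic: "finite {\<omega>::real. \<i> * of_real \<omega> \<notin> ?\<sigma> \<and>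
      vec.dim (?V (\<i> * of_real \<omega>)) \<noteq> Min {vec.dim (?V z) | z. z \<notin> ?\<sigma>}}"
    (is "finite ?bad")
  proof (cases "?\<sigma> = UNIV")
    case False
    let ?dims = "{vec.dim (?V z) | z. z \<notin> ?\<sigma>}"
    have "Min ?dims \<in> ?dims"
      using False by (intro Min_in finite_dims) auto
    then obtain z0 where z0: "z0 \<notin> ?\<sigma>" "Min ?dims = vec.dim (?V z0)"
      by blast
    have "vec.dim (?V z0) \<le> vec.dim (?V z)" if "z \<notin> ?\<sigma>" for z
      unfolding z0(2)[symmetric] using that by (intro Min_le finite_dims) auto
    then have "?bad \<subseteq> {\<omega>. \<i> * of_real \<omega> \<in> {z. vec.dim (?V z0) < vec.dim (?V z)}}"
      unfolding z0(2) by (auto simp: order_less_le)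
    then show ?thesis
      using finite_imaginary_part[OF finite_dim_pre_space_greater[OF z0(1)]] by (rule finite_subset)
  qed simp
  show ?thesis
    unfolding Let_def
    using weight[of _ _ UNIV] weight[of _ _ "- ?\<sigma>"] projection generic by simp
qed

end
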